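(* Let $(S_i,v_i)$ be a normed monoid and $\phi_i:S_i\to S_i$ an endomorphism for $i=1,2$; moreover, let $(S,v)=(S_1\oplus S_2,v_\oplus)$ and $\phi=\phi_1\oplus\phi_2:S\to S$. Then $h_{\mathfrak S}(\phi)\le h_{\mathfrak S}(\phi_1)+h_{\mathfrak S}(\phi_2)$. If $v$ is subadditive, then $h_{\mathfrak S}(\phi)=h_{\mathfrak S}(\phi_1)+h_{\mathfrak S}(\phi_2)$.
   Context: A normed monoid $(S,v)$ is a monoid $S$ with a function $v:S\to\mathbb R_{\ge0}$ such that $v(1)=0$. Endomorphisms are contractive monoid endomorphisms: $v(\phi(x))\le v(x)$ for all $x$. The norm $v$ is subadditive if $v(x\cdot y)\le v(x)+v(y)$ for all $x,y\in S$. The direct sum $S_1\oplus S_2$ is the monoid $S_1\times S_2$ with norm $v_\oplus(x_1,x_2)=v_1(x_1)+v_2(x_2)$, and $\phi_1\oplus\phi_2$ acts componentwise. For $x\in S$, $T_n(\phi,x)=x\cdot\phi(x)\cdots\phi^{n-1}(x)$, $h_{\mathfrak S}(\phi,x)=\limsup_{n\to\infty}\frac{v(T_n(\phi,x))}{n}$, and $h_{\mathfrak S}(\phi)=\sup_{x\in S}h_{\mathfrak S}(\phi,x)\in[0,\infty]$. *)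

theory Defs
  imports "HOL-Analysis.Analysis" "HOL-Algebra.Group"
begin

locale normed_monoid = monoid S for S (structure) and v :: "'a \<Rightarrow> real" +
  assumes norm_nonneg: "x \<in> carrier S \<Longrightarrow> 0 \<le> v x"
    and norm_one: "v \<one> = 0"

definition subadditive_norm :: "('a, 'b) monoid_scheme \<Rightarrow> ('a \<Rightarrow> real) \<Rightarrow> bool" where
  "subadditive_norm S v \<longleftrightarrow>
     (\<forall>x\<in>carrier S. \<forall>y\<in>carrier S. v (x \<otimes>\<^bsub>S\<^esub> y) \<le> v x + v y)"

text \<open>For monoids, \<open>hom\<close> does not include preservation of the neutral element, so it is
  required separately.\<close>

definition normed_monoid_endo ::
    "('a, 'b) monoid_scheme \<Rightarrow> ('a \<Rightarrow> real) \<Rightarrow> ('a \<Rightarrow> 'a) \<Rightarrow> bool" where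
  "normed_monoid_endo S v \<phi> \<longleftrightarrow>
     \<phi> \<in> hom S S \<and> \<phi> \<one>\<^bsub>S\<^esub> = \<one>\<^bsub>S\<^esub> \<and> (\<forall>x\<in>carrier S. v (\<phi> x) \<le> v x)"

primrec trajectory ::
    "('a, 'b) monoid_scheme \<Rightarrow> ('a \<Rightarrow> 'a) \<Rightarrow> 'a \<Rightarrow> nat \<Rightarrow> 'a" where
  "trajectory S \<phi> x 0 = \<one>\<^bsub>S\<^esub>"
| "trajectory S \<phi> x (Suc n) = trajectory S \<phi> x n \<otimes>\<^bsub>S\<^esub> (\<phi> ^^ n) x"

text \<open>Entropies take values in \<open>[0,\<infinity>]\<close>. The coercion \<open>ennreal\<close> truncates negative reals, but
  it is only applied to non-negative ones here, and the term at \<open>n = 0\<close> does not affect the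
  limit superior.\<close>

definition entropy_at ::
    "('a, 'b) monoid_scheme \<Rightarrow> ('a \<Rightarrow> real) \<Rightarrow> ('a \<Rightarrow> 'a) \<Rightarrow> 'a \<Rightarrow> ennreal" where
  "entropy_at S v \<phi> x = limsup (\<lambda>n. ennreal (v (trajectory S \<phi> x n) / real n))"

definition entropy ::
    "('a, 'b) monoid_scheme \<Rightarrow> ('a \<Rightarrow> real) \<Rightarrow> ('a \<Rightarrow> 'a) \<Rightarrow> ennreal" where
  "entropy S v \<phi> = (SUP x\<in>carrier S. entropy_at S v \<phi> x)"

definition sum_norm :: "('a \<Rightarrow> real) \<Rightarrow> ('b \<Rightarrow> real) \<Rightarrow> 'a \<times> 'b \<Rightarrow> real" where
  "sum_norm v1 v2 = (\<lambda>(x1, x2). v1 x1 + v2 x2)"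

lemma normed_monoid_direct_sum:
  assumes "normed_monoid S1 v1" and "normed_monoid S2 v2"
  shows "normed_monoid (S1 \<times>\<times> S2) (sum_norm v1 v2)"
proof -
  interpret S1: normed_monoid S1 v1 by fact
  interpret S2: normed_monoid S2 v2 by fact
  interpret S: monoid "S1 \<times>\<times> S2"
    by (rule DirProd_monoid) (fact S1.monoid_axioms S2.monoid_axioms)+
  show ?thesis
    by unfold_locales
      (auto simp: sum_norm_def S1.norm_one S2.norm_one S1.norm_nonneg S2.norm_nonneg)
qed

lemma normed_monoid_endo_direct_sum:
  assumes "normed_monoid_endo S1 v1 \<phi>1" and "normed_monoid_endo S2 v2 \<phi>2"
  shows "normed_monoid_endo (S1 \<times>\<times> S2) (sum_norm v1 v2) (map_prod \<phi>1 \<phi>2)"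
  using assms
  by (auto simp: normed_monoid_endo_def hom_def sum_norm_def Pi_iff intro!: add_mono)

end

theory Submission
  imports Defs
begin

text \<open>The trajectory of a pair is the pair of trajectories, and the limit superior is subadditive;
  this gives the inequality. A subadditive norm is subadditive on each summand, and contractivity makes
  \<open>n \<mapsto> v (T\<^sub>n(\<phi>, x))\<close> a subadditive sequence, so by Fekete's lemma the limits superior are
  limits, hence additive.\<close>

lemma subadditive_le_mult:
  fixes c :: "nat \<Rightarrow> real"
  assumes "c 0 = 0" and sub: "\<And>m n. c (m + n) \<le> c m + c n"
  shows "c (k * m) \<le> real k * c m"
proof (induction k)
  case (Suc k)
  then show ?case using sub[of m "k * m"] by (simp add: algebra_simps)
qed (simp add: assms)

text \<open>Division with remainder by a fixed \<open>m\<close> bounds \<open>c n / real n\<close>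
  by \<open>c m / real m\<close> plus an error that vanishes as \<open>n\<close> grows, so the
  quotients converge to their infimum.\<close>

lemma fekete_convergent:
  fixes c :: "nat \<Rightarrow> real"
  assumes c0: "c 0 = 0" and nonneg: "\<And>n. 0 \<le> c n"
    and sub: "\<And>m n. c (m + n) \<le> c m + c n"
  shows "convergent (\<lambda>n. c n / real n)"
proof -
  \<comment> \<open>Index 0 is left out: \<open>c 0 / real 0\<close> is 0 by convention, which would
    force the infimum of these nonnegative quotients down to 0.\<close>
  define L where "L = (INF m\<in>{1..}. c m / real m)"
  have bdd: "bdd_below ((\<lambda>m. c m / real m) ` {1..})"
    by (rule bdd_belowI[of _ 0]) (auto simp: nonneg)
  have lower: "L \<le> c n / real n" if "n \<ge> 1" for n
    unfolding L_def using bdd that by (intro cINF_lower) auto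
  have bound: "c n / real n \<le> c m / real m + real m * c 1 / real n" if "m \<ge> 1" "n \<ge> 1" for m n
  proof -
    \<comment> \<open>Split \<open>n\<close> into \<open>n div m\<close> blocks of length
      \<open>m\<close> and a remainder. The remainder is below \<open>m\<close>, so cutting it into
      unit steps costs at most \<open>real m * c 1\<close>, independently of
      \<open>n\<close>.\<close>
    have "c n \<le> c (n div m * m) + c (n mod m)"
      using sub[of "n div m * m" "n mod m"] by simp
    also have "c (n div m * m) \<le> real (n div m) * c m"
      using subadditive_le_mult[OF c0 sub] .
    also have "\<dots> \<le> real n / real m * c m"
      by (intro mult_right_mono nonneg) (rule of_nat_div_le_of_nat)
    also have "c (n mod m) \<le> real (n mod m) * c 1"
      using subadditive_le_mult[OF c0 sub, of "n mod m" 1] by simp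
    also have "\<dots> \<le> real m * c 1"
      using that by (intro mult_right_mono nonneg) simp
    finally have "c n \<le> real n / real m * c m + real m * c 1" by simp
    then show ?thesis using that by (simp add: field_simps)
  qed
  have "(\<lambda>n. c n / real n) \<longlonglongrightarrow> L"
  proof (rule order_tendstoI)
    fix a assume "a < L"
    then show "\<forall>\<^sub>F n in sequentially. a < c n / real n"
      using lower by (intro eventually_sequentiallyI[of 1]) force
  next
    fix a assume "L < a"
    \<comment> \<open>Some quotient of the infimum already lies below \<open>a\<close>. With this
      \<open>m\<close> fixed, the right-hand side of \<open>bound\<close> tends to
      \<open>c m / real m\<close>, hence is eventually below \<open>a\<close> too.\<close>
    then obtain m where m: "m \<ge> 1" "c m / real m < a"
      unfolding L_def using bdd by (subst (asm) cINF_less_iff) auto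
    have "(\<lambda>n. c m / real m + real m * c 1 / real n) \<longlonglongrightarrow> c m / real m + 0"
      by (intro tendsto_add tendsto_const lim_const_over_n)
    then have "\<forall>\<^sub>F n in sequentially. c m / real m + real m * c 1 / real n < a"
      using m(2) by (intro order_tendstoD(2)) simp_all
    then show "\<forall>\<^sub>F n in sequentially. c n / real n < a"
      using eventually_ge_at_top[of 1] by eventually_elim (use bound m(1) in force)
  qed
  then show ?thesis by (rule convergentI)
qed

text \<open>The sum of the two suprema over the tail from \<open>n\<close> bounds the limit superior
  of the sum for every \<open>n\<close>. Tail suprema decrease to the limits superior, and addition
  is continuous on \<open>ennreal\<close>, so the bound survives in the limit.\<close>

lemma limsup_add_le_ennreal:
  fixes f g :: "nat \<Rightarrow> ennreal"
  shows "limsup (\<lambda>n. f n + g n) \<le> limsup f + limsup g"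
proof (rule LIMSEQ_le_const)
  have tails: "(\<lambda>n. SUP m\<in>{n..}. h m) \<longlonglongrightarrow> limsup h" for h :: "nat \<Rightarrow> ennreal"
    unfolding limsup_INF_SUP by (intro LIMSEQ_INF decseq_SucI SUP_subset_mono) auto
  show "(\<lambda>n. (SUP m\<in>{n..}. f m) + (SUP m\<in>{n..}. g m)) \<longlonglongrightarrow> limsup f + limsup g"
    by (intro tendsto_add tails)
  have "limsup (\<lambda>n. f n + g n) \<le> (SUP m\<in>{n..}. f m) + (SUP m\<in>{n..}. g m)" for n
    unfolding limsup_INF_SUP
    by (rule INF_lower2[of n]) (auto intro!: SUP_least add_mono SUP_upper)
  then show "\<exists>N. \<forall>n\<ge>N. limsup (\<lambda>n. f n + g n) \<le> (SUP m\<in>{n..}. f m) + (SUP m\<in>{n..}. g m)"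
    by blast
qed

lemma normed_monoid_endo_funpow:
  assumes "normed_monoid_endo S v \<phi>"
  shows "normed_monoid_endo S v (\<phi> ^^ n)"
proof (induction n)
  case (Suc n)
  then show ?case using assms
    by (force simp: normed_monoid_endo_def hom_def Pi_iff intro: order_trans)
qed (auto simp: normed_monoid_endo_def hom_def)

context normed_monoid
begin

lemma trajectory_closed:
  assumes "normed_monoid_endo S v \<phi>" "x \<in> carrier S"
  shows "trajectory S \<phi> x n \<in> carrier S"
  using normed_monoid_endo_funpow[OF assms(1)] assms(2)
  by (induction n) (auto simp: normed_monoid_endo_def hom_def Pi_iff)

text \<open>The last \<open>n\<close> factors of the longer product are the images under
  \<open>\<phi> ^^ m\<close> of the first \<open>n\<close> factors, and \<open>\<phi> ^^ m\<close>
  is multiplicative. This factorization is the source of subadditivity in the index.\<close>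

lemma trajectory_add:
  assumes \<phi>: "normed_monoid_endo S v \<phi>" and x: "x \<in> carrier S"
  shows "trajectory S \<phi> x (m + n) = trajectory S \<phi> x m \<otimes> (\<phi> ^^ m) (trajectory S \<phi> x n)"
proof (induction n)
  case 0
  \<comment> \<open>Here \<open>\<phi> ^^ m\<close> is applied to the empty product, so preservation
    of the neutral element enters.\<close>
  then show ?case
    using normed_monoid_endo_funpow[OF \<phi>, of m] trajectory_closed[OF \<phi> x, of m]
    by (simp add: normed_monoid_endo_def)
next
  case (Suc n)
  have closed: "(\<phi> ^^ k) y \<in> carrier S" if "y \<in> carrier S" for k y
    using normed_monoid_endo_funpow[OF \<phi>] that by (auto simp: normed_monoid_endo_def hom_def Pi_iff)
  have "(\<phi> ^^ m) (trajectory S \<phi> x (Suc n))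
      = (\<phi> ^^ m) (trajectory S \<phi> x n) \<otimes> (\<phi> ^^ (m + n)) x"
    using normed_monoid_endo_funpow[OF \<phi>, of m] trajectory_closed[OF \<phi> x, of n] closed[OF x, of n]
    by (simp add: normed_monoid_endo_def hom_def funpow_add)
  then show ?case
    using Suc closed x trajectory_closed[OF \<phi> x] by (simp add: m_assoc)
qed

lemma convergent_norm_trajectory:
  assumes sub: "subadditive_norm S v"
    and \<phi>: "normed_monoid_endo S v \<phi>" and x: "x \<in> carrier S"
  shows "convergent (\<lambda>n. v (trajectory S \<phi> x n) / real n)"
proof (rule fekete_convergent)
  fix m n
  note closed = trajectory_closed[OF \<phi> x]
  have "(\<phi> ^^ m) (trajectory S \<phi> x n) \<in> carrier S"
    and contr: "v ((\<phi> ^^ m) (trajectory S \<phi> x n)) \<le> v (trajectory S \<phi> x n)"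
    using normed_monoid_endo_funpow[OF \<phi>, of m] closed[of n]
    by (auto simp: normed_monoid_endo_def hom_def)
  then show "v (trajectory S \<phi> x (m + n)) \<le> v (trajectory S \<phi> x m) + v (trajectory S \<phi> x n)"
    using sub closed[of m] unfolding trajectory_add[OF \<phi> x] subadditive_norm_def
    by (meson add_left_mono order_trans)
\<comment> \<open>The sequence starts at 0 because the empty product is the neutral element, which
  has norm 0.\<close>
qed (use trajectory_closed[OF \<phi> x] norm_nonneg norm_one in auto)

end

lemma trajectory_direct_sum:
  "trajectory (S1 \<times>\<times> S2) (map_prod \<phi>1 \<phi>2) (x, y) n
    = (trajectory S1 \<phi>1 x n, trajectory S2 \<phi>2 y n)"
proof (induction n)
  case (Suc n)
  have "(map_prod \<phi>1 \<phi>2 ^^ n) (x, y) = ((\<phi>1 ^^ n) x, (\<phi>2 ^^ n) y)"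
    by (induction n) auto
  with Suc show ?case by simp
qed simp

text \<open>Putting the neutral element, of norm 0, into the other coordinate reduces the inequality
  for pairs to one for a single summand.\<close>

lemma subadditive_norm_direct_sumD:
  assumes "normed_monoid S1 v1" and "normed_monoid S2 v2"
    and sub: "subadditive_norm (S1 \<times>\<times> S2) (sum_norm v1 v2)"
  shows "subadditive_norm S1 v1" and "subadditive_norm S2 v2"
proof -
  interpret S1: normed_monoid S1 v1 by fact
  interpret S2: normed_monoid S2 v2 by fact
  have sub': "v1 (x \<otimes>\<^bsub>S1\<^esub> x') + v2 (y \<otimes>\<^bsub>S2\<^esub> y') \<le> (v1 x + v2 y) + (v1 x' + v2 y')"
    if "x \<in> carrier S1" "x' \<in> carrier S1" "y \<in> carrier S2" "y' \<in> carrier S2" for x x' y y'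
    using sub that by (force simp: subadditive_norm_def sum_norm_def)
  show "subadditive_norm S1 v1"
    using sub'[of _ _ "\<one>\<^bsub>S2\<^esub>" "\<one>\<^bsub>S2\<^esub>"] by (auto simp: subadditive_norm_def S2.norm_one)
  show "subadditive_norm S2 v2"
    using sub'[of "\<one>\<^bsub>S1\<^esub>" "\<one>\<^bsub>S1\<^esub>"] by (auto simp: subadditive_norm_def S1.norm_one)
qed

theorem theorem3p19:
  fixes S1 :: "('a, 'm) monoid_scheme" and v1 :: "'a \<Rightarrow> real" and \<phi>1 :: "'a \<Rightarrow> 'a"
    and S2 :: "('b, 'n) monoid_scheme" and v2 :: "'b \<Rightarrow> real" and \<phi>2 :: "'b \<Rightarrow> 'b"
  assumes "normed_monoid S1 v1" and "normed_monoid S2 v2"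
    and "normed_monoid_endo S1 v1 \<phi>1" and "normed_monoid_endo S2 v2 \<phi>2"
  shows "entropy (S1 \<times>\<times> S2) (sum_norm v1 v2) (map_prod \<phi>1 \<phi>2)
           \<le> entropy S1 v1 \<phi>1 + entropy S2 v2 \<phi>2 \<and>
         (subadditive_norm (S1 \<times>\<times> S2) (sum_norm v1 v2) \<longrightarrow>
           entropy (S1 \<times>\<times> S2) (sum_norm v1 v2) (map_prod \<phi>1 \<phi>2)
             = entropy S1 v1 \<phi>1 + entropy S2 v2 \<phi>2)"
proof -
  interpret S1: normed_monoid S1 v1 by fact
  interpret S2: normed_monoid S2 v2 by fact
  let ?S = "S1 \<times>\<times> S2" and ?v = "sum_norm v1 v2" and ?\<phi> = "map_prod \<phi>1 \<phi>2"
  let ?a = "\<lambda>x n. ennreal (v1 (trajectory S1 \<phi>1 x n) / real n)"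
    and ?b = "\<lambda>y n. ennreal (v2 (trajectory S2 \<phi>2 y n) / real n)"
  \<comment> \<open>Both norms are nonnegative on trajectories, so \<open>ennreal\<close>
    distributes over the sum of the quotients.\<close>
  have at: "entropy_at ?S ?v ?\<phi> (x, y) = limsup (\<lambda>n. ?a x n + ?b y n)"
    if "x \<in> carrier S1" "y \<in> carrier S2" for x y
    using that assms
    by (simp add: entropy_at_def trajectory_direct_sum sum_norm_def add_divide_distrib ennreal_plus
        S1.norm_nonneg S2.norm_nonneg S1.trajectory_closed S2.trajectory_closed)
  have le: "entropy ?S ?v ?\<phi> \<le> entropy S1 v1 \<phi>1 + entropy S2 v2 \<phi>2"
    unfolding entropy_def
  proof (rule SUP_least)
    fix z assume "z \<in> carrier ?S"
    then obtain x y where z: "z = (x, y)" "x \<in> carrier S1" "y \<in> carrier S2" by auto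
    have "entropy_at ?S ?v ?\<phi> z \<le> entropy_at S1 v1 \<phi>1 x + entropy_at S2 v2 \<phi>2 y"
      using z at limsup_add_le_ennreal by (simp add: entropy_at_def)
    also have "\<dots> \<le> (SUP x\<in>carrier S1. entropy_at S1 v1 \<phi>1 x)
                   + (SUP y\<in>carrier S2. entropy_at S2 v2 \<phi>2 y)"
      using z by (intro add_mono SUP_upper)
    finally show "entropy_at ?S ?v ?\<phi> z \<le> \<dots>" .
  qed
  have ge: "entropy S1 v1 \<phi>1 + entropy S2 v2 \<phi>2 \<le> entropy ?S ?v ?\<phi>"
    if "subadditive_norm ?S ?v"
  proof -
    note sub = subadditive_norm_direct_sumD[OF assms(1,2) that]
    \<comment> \<open>It suffices to treat one pair of points: both sequences converge, so each
      limit superior is a limit and the limits add up.\<close>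
    have "entropy_at S1 v1 \<phi>1 x + entropy_at S2 v2 \<phi>2 y \<le> entropy ?S ?v ?\<phi>"
      if xy: "x \<in> carrier S1" "y \<in> carrier S2" for x y
    proof -
      obtain A where "(\<lambda>n. v1 (trajectory S1 \<phi>1 x n) / real n) \<longlonglongrightarrow> A"
        using S1.convergent_norm_trajectory[OF sub(1) assms(3) xy(1)] by (auto simp: convergent_def)
      then have a: "?a x \<longlonglongrightarrow> ennreal A" by (rule tendsto_ennrealI)
      obtain B where "(\<lambda>n. v2 (trajectory S2 \<phi>2 y n) / real n) \<longlonglongrightarrow> B"
        using S2.convergent_norm_trajectory[OF sub(2) assms(4) xy(2)] by (auto simp: convergent_def)
      then have b: "?b y \<longlonglongrightarrow> ennreal B" by (rule tendsto_ennrealI)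
      have "entropy_at S1 v1 \<phi>1 x + entropy_at S2 v2 \<phi>2 y = ennreal A + ennreal B"
        unfolding entropy_at_def using a b by (simp add: lim_imp_Limsup)
      also have "\<dots> = entropy_at ?S ?v ?\<phi> (x, y)"
        unfolding at[OF xy] by (rule lim_imp_Limsup[symmetric]) (auto intro: tendsto_add a b)
      also have "\<dots> \<le> entropy ?S ?v ?\<phi>"
        unfolding entropy_def using xy by (intro SUP_upper) simp
      finally show ?thesis .
    qed
    \<comment> \<open>In \<open>ennreal\<close>, a constant summand moves across a supremum over a
      nonempty index set. Doing this for \<open>x\<close> and for \<open>y\<close> turns the sum of
      the two suprema into an iterated supremum over pairs.\<close>
    moreover have "carrier S1 \<noteq> {}" "carrier S2 \<noteq> {}" by auto
    ultimately show ?thesis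
      unfolding entropy_def[of S1] entropy_def[of S2]
      by (simp add: ennreal_SUP_add_left[symmetric] ennreal_SUP_add_right SUP_le_iff)
  qed
  show ?thesis using le ge by (auto intro: antisym)
qed

end
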